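(* Let $N$ be a finite set of $n$ agents and $A$ a finite set of object types with quotas $(q_a)_{a\in A}$ satisfying $\sum_{a\in A}q_a\ge n$. If a rule $\varphi:\mathscr{P}^{n}\to\Pi$ satisfies sd-rank-fairness, then $\varphi$ also satisfies sd-efficiency.
   Context: **Model.** $N=\{1,\dots,n\}$ is a finite set of agents and $A=\{a_1,\dots,a_m\}$ a finite set of object types. Each $a\in A$ has a supply (quota, number of copies) $q_a$, a positive integer, and $\sum_{a\in A}q_a\ge n$. $N$, $A$ and $(q_a)_{a\in A}$ are fixed. $\mathscr{P}$ is the set of all strict preferences (strict linear orders) on $A$. A preference profile is $P=(P_1,\dots,P_n)\in\mathscr{P}^n$, where $a\,P_i\,b$ means that agent $i$ strictly prefers $a$ to $b$. The rank of $a$ at $P_i$ is $P_i(a)=l$ if $a$ is the $l$-th choice of $i$ under $P_i$ (so the favorite object has rank 1). Let $U(P_i,a)=\{b\in A: b\,P_i\,a\}$ and $\widehat U(P_i,a)=U(P_i,a)\cup\{a\}$. A random assignment is an $n\times m$ matrix $\pi=(\pi_{ia})$ with nonnegative entries such that $\sum_{a\in A}\pi_{ia}=1$ for each $i\in N$ and $\sum_{i\in N}\pi_{ia}\le q_a$ for each $a\in A$. $\Pi$ is the set of all random assignments; $\pi_i$ denotes row $i$ of $\pi$. A rule is a mapping $\varphi:\mathscr{P}^n\to\Pi$; $\varphi_i(P)$ is row $i$ and $\varphi_{ia}(P)$ the $(i,a)$ entry of $\varphi(P)$. **Weak stochastic dominance.** $\pi_i\ sd(P_i)\ \pi'_i$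 means $\sum_{a'\in\widehat U(P_i,a)}\pi_{ia'}\ge\sum_{a'\in\widehat U(P_i,a)}\pi'_{ia'}$ for each $a\in A$. **Sd-efficiency.** $\varphi$ is sd-efficient if for each $P\in\mathscr{P}^n$ there exists no $\pi\in\Pi$ such that $\pi_i\ sd(P_i)\ \varphi_i(P)$ for each $i\in N$ and $\pi\ne\varphi(P)$. **Sd-rank-fairness.** $\varphi$ satisfies sd-rank-fairness if for each $P\in\mathscr{P}^n$, $i\in N$ and $a\in A$, $\varphi_{ia}(P)>0$ implies (i) $\sum_{j\in N}\varphi_{ja'}(P)=q_{a'}$ for all $a'$ such that $a'\,P_i\,a$; and (ii) $\sum_{a'\in\widehat U(P_j,a)}\varphi_{ja'}(P)=1$ for each $j\in N$ such that $P_j(a)<P_i(a)$. *)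

theory Defs
  imports Complex_Main "HOL-Library.FuncSet"
begin

text \<open>
  A strict preference is the graph \<open>R\<close> of a strict linear order on \<open>A\<close>, where \<open>(b, a) \<in> R\<close> reads
  ``\<open>b\<close> is strictly preferred to \<open>a\<close>''. The inclusion in \<open>A \<times> A\<close> is stated separately because
  \<^const>\<open>strict_linear_order_on\<close> does not bound the field of the relation.
\<close>

definition prefs :: "'a set \<Rightarrow> 'a rel set" where
  "prefs A = {R. R \<subseteq> A \<times> A \<and> strict_linear_order_on A R}"

definition profiles :: "'i set \<Rightarrow> 'a set \<Rightarrow> ('i \<Rightarrow> 'a rel) set" where
  "profiles N A = (N \<rightarrow>\<^sub>E prefs A)"

definition upper :: "'a set \<Rightarrow> 'a rel \<Rightarrow> 'a \<Rightarrow> 'a set" where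
  "upper A R a = {b \<in> A. (b, a) \<in> R}"

definition upper_eq :: "'a set \<Rightarrow> 'a rel \<Rightarrow> 'a \<Rightarrow> 'a set" where
  "upper_eq A R a = upper A R a \<union> {a}"

definition pref_rank :: "'a set \<Rightarrow> 'a rel \<Rightarrow> 'a \<Rightarrow> nat" where
  "pref_rank A R a = card (upper A R a) + 1"

text \<open>
  Matrices are functions that are extensional in both indices (\<open>undefined\<close> off \<open>N\<close> and off \<open>A\<close>),
  so HOL equality of two random assignments is equality of all their entries on \<open>N \<times> A\<close>.
\<close>

definition random_assignments :: "'i set \<Rightarrow> 'a set \<Rightarrow> ('a \<Rightarrow> nat) \<Rightarrow> ('i \<Rightarrow> 'a \<Rightarrow> real) set" where
  "random_assignments N A q =
    {\<pi> \<in> N \<rightarrow>\<^sub>E (A \<rightarrow>\<^sub>E {0..}).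
      (\<forall>i\<in>N. (\<Sum>a\<in>A. \<pi> i a) = 1) \<and>
      (\<forall>a\<in>A. (\<Sum>i\<in>N. \<pi> i a) \<le> real (q a))}"

definition rules ::
  "'i set \<Rightarrow> 'a set \<Rightarrow> ('a \<Rightarrow> nat) \<Rightarrow> (('i \<Rightarrow> 'a rel) \<Rightarrow> 'i \<Rightarrow> 'a \<Rightarrow> real) set" where
  "rules N A q = (profiles N A \<rightarrow> random_assignments N A q)"

definition sd :: "'a set \<Rightarrow> 'a rel \<Rightarrow> ('a \<Rightarrow> real) \<Rightarrow> ('a \<Rightarrow> real) \<Rightarrow> bool" where
  "sd A R p p' \<longleftrightarrow>
    (\<forall>a\<in>A. (\<Sum>a'\<in>upper_eq A R a. p a') \<ge> (\<Sum>a'\<in>upper_eq A R a. p' a'))"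

definition sd_efficient ::
  "'i set \<Rightarrow> 'a set \<Rightarrow> ('a \<Rightarrow> nat) \<Rightarrow> (('i \<Rightarrow> 'a rel) \<Rightarrow> 'i \<Rightarrow> 'a \<Rightarrow> real) \<Rightarrow> bool" where
  "sd_efficient N A q \<phi> \<longleftrightarrow>
    (\<forall>P\<in>profiles N A.
      \<not> (\<exists>\<pi>\<in>random_assignments N A q. (\<forall>i\<in>N. sd A (P i) (\<pi> i) (\<phi> P i)) \<and> \<pi> \<noteq> \<phi> P))"

definition sd_rank_fair ::
  "'i set \<Rightarrow> 'a set \<Rightarrow> ('a \<Rightarrow> nat) \<Rightarrow> (('i \<Rightarrow> 'a rel) \<Rightarrow> 'i \<Rightarrow> 'a \<Rightarrow> real) \<Rightarrow> bool" where
  "sd_rank_fair N A q \<phi> \<longleftrightarrow>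
    (\<forall>P\<in>profiles N A. \<forall>i\<in>N. \<forall>a\<in>A. \<phi> P i a > 0 \<longrightarrow>
      (\<forall>a'\<in>A. (a', a) \<in> P i \<longrightarrow> (\<Sum>j\<in>N. \<phi> P j a') = real (q a')) \<and>
      (\<forall>j\<in>N. pref_rank A (P j) a < pref_rank A (P i) a \<longrightarrow>
        (\<Sum>a'\<in>upper_eq A (P j) a. \<phi> P j a') = 1))"

end

theory Submission
  imports Defs
begin

text \<open>
  If \<open>\<pi>\<close> weakly sd-dominates \<open>\<phi> P\<close>, then the two agree on every entry \<open>(i, a)\<close>, by strong induction
  on the rank \<open>r\<close> of \<open>a\<close> at \<open>P i\<close>. Agreement at smaller ranks and dominance give
  \<open>\<pi> i a \<ge> \<phi> P i a\<close>. Were this strict, then \<open>i\<close> would get an object worse than \<open>a\<close> with positive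
  probability under \<open>\<phi> P\<close>, so \<open>a\<close> would be exhausted by condition (i), and some \<open>j\<close> would have
  \<open>\<pi> j a < \<phi> P j a\<close>. For such a \<open>j\<close> the rank of \<open>a\<close> exceeds \<open>r\<close>, so condition (ii) says that \<open>i\<close> gets
  under \<open>\<phi> P\<close> nothing worse than \<open>a\<close>, a contradiction.
\<close>

lemma pref_rank_less:
  assumes "finite A" "R \<in> prefs A" "(b, a) \<in> R"
  shows "pref_rank A R b < pref_rank A R a"
proof -
  have R: "trans R" "irrefl R" "R \<subseteq> A \<times> A"
    using assms(2) by (auto simp: prefs_def strict_linear_order_on_def)
  have "upper A R b \<subseteq> upper A R a"
    using R(1) assms(3) by (auto simp: upper_def dest: transD)
  moreover have "b \<in> upper A R a" "b \<notin> upper A R b"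
    using R assms(3) by (auto simp: upper_def irrefl_def)
  ultimately have "upper A R b \<subset> upper A R a" by blast
  then show ?thesis
    using assms(1) by (simp add: pref_rank_def upper_def psubset_card_mono)
qed

lemma sum_upper_eq:
  assumes "finite A" "R \<in> prefs A"
  shows "(\<Sum>b\<in>upper_eq A R a. p b) = p a + (\<Sum>b\<in>upper A R a. p b)"
proof -
  have "a \<notin> upper A R a"
    using assms(2) by (auto simp: prefs_def strict_linear_order_on_def irrefl_def upper_def)
  then show ?thesis
    using assms(1) by (simp add: upper_eq_def upper_def)
qed

text \<open>Cancelling the common mass strictly above \<open>a\<close> turns the dominance
  inequality for the upper set of \<open>a\<close> into an inequality for the single entry at
  \<open>a\<close>.\<close>

lemma sd_agree_above:
  assumes "finite A" "R \<in> prefs A" "a \<in> A" "sd A R p p'"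
    and "\<And>b. b \<in> upper A R a \<Longrightarrow> p b = p' b"
  shows "p a \<ge> p' a"
proof -
  have "(\<Sum>b\<in>upper A R a. p b) = (\<Sum>b\<in>upper A R a. p' b)"
    using assms(5) by (rule sum.cong[OF refl])
  moreover have "(\<Sum>b\<in>upper_eq A R a. p b) \<ge> (\<Sum>b\<in>upper_eq A R a. p' b)"
    using assms(3,4) by (simp add: sd_def)
  ultimately show ?thesis
    using sum_upper_eq[OF assms(1,2)] by (metis add_le_cancel_right)
qed

lemma sd_rank_fair_dominating_eq:
  assumes fin: "finite N" "finite A" and P: "P \<in> profiles N A"
    and \<phi>: "\<phi> P \<in> random_assignments N A q" and fair: "sd_rank_fair N A q \<phi>"
    and \<pi>: "\<pi> \<in> random_assignments N A q"
    and dom: "\<And>i. i \<in> N \<Longrightarrow> sd A (P i) (\<pi> i) (\<phi> P i)"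
    and "i \<in> N" "a \<in> A"
  shows "\<pi> i a = \<phi> P i a"
  using \<open>i \<in> N\<close> \<open>a \<in> A\<close>
\<comment> \<open>Agents must vary too: the step for \<open>i\<close> needs agreement in the rows of
  other agents \<open>j\<close>.\<close>
proof (induction "pref_rank A (P i) a" arbitrary: i a rule: less_induct)
  case less
  have pref: "P j \<in> prefs A" if "j \<in> N" for j
    using P that by (auto simp: profiles_def)
  have agree: "\<pi> j b = \<phi> P j b"
    if "j \<in> N" "pref_rank A (P j) a \<le> pref_rank A (P i) a" "b \<in> upper A (P j) a" for j b
    using less.hyps[of j b] pref_rank_less[OF fin(2) pref[OF that(1)], of b a] that
    by (auto simp: upper_def)
  have ge: "\<pi> j a \<ge> \<phi> P j a"
    if "j \<in> N" "pref_rank A (P j) a \<le> pref_rank A (P i) a" for j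
    using sd_agree_above[OF fin(2) pref[OF that(1)] less.prems(2) dom[OF that(1)] agree[OF that]] .
  show ?case
  proof (rule ccontr)
    assume "\<pi> i a \<noteq> \<phi> P i a"
    with ge[of i] less.prems(1) have gt: "\<pi> i a > \<phi> P i a" by simp
    let ?U = "upper_eq A (P i) a"
    have U: "?U \<subseteq> A" using less.prems(2) by (auto simp: upper_eq_def upper_def)
    have "(\<Sum>b\<in>?U. \<phi> P i b) < (\<Sum>b\<in>?U. \<pi> i b)"
      using gt agree[OF less.prems(1)]
      by (simp add: sum_upper_eq[OF fin(2) pref[OF less.prems(1)]] cong: sum.cong)
    also have "\<dots> \<le> (\<Sum>b\<in>A. \<pi> i b)"
      using \<pi> less.prems(1) fin(2) U
      by (intro sum_mono2) (auto simp: random_assignments_def PiE_iff)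
    also have "\<dots> = 1"
      using \<pi> less.prems(1) by (simp add: random_assignments_def)
    finally have lt1: "(\<Sum>b\<in>?U. \<phi> P i b) < 1" .
    moreover have "(\<Sum>b\<in>A. \<phi> P i b) = 1"
      using \<phi> less.prems(1) by (simp add: random_assignments_def)
    ultimately have "(\<Sum>b\<in>A - ?U. \<phi> P i b) > 0"
      using sum.subset_diff[OF U fin(2), of "\<phi> P i"] by linarith
    then obtain b where b: "b \<in> A - ?U" "\<phi> P i b > 0"
      by (metis not_less sum_nonpos)
    \<comment> \<open>By totality, an object outside the upper set of \<open>a\<close> is worse than
      \<open>a\<close>.\<close>
    have "(a, b) \<in> P i"
      using pref[OF less.prems(1)] b(1) less.prems(2)
      by (auto simp: prefs_def strict_linear_order_on_def total_on_def upper_eq_def upper_def)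
    then have "(\<Sum>j\<in>N. \<phi> P j a) = real (q a)"
      using fair P less.prems b unfolding sd_rank_fair_def by blast
    moreover have "(\<Sum>j\<in>N. \<pi> j a) \<le> real (q a)"
      using \<pi> less.prems(2) by (simp add: random_assignments_def)
    \<comment> \<open>Otherwise column \<open>a\<close> of \<pi>, weakly larger everywhere and
      strictly larger at \<open>i\<close>, would sum to more than \<open>q a\<close>.\<close>
    ultimately obtain j where j: "j \<in> N" "\<pi> j a < \<phi> P j a"
      using gt sum_strict_mono_ex1[OF fin(1), of "\<lambda>j. \<phi> P j a" "\<lambda>j. \<pi> j a"] less.prems(1)
      by fastforce
    have "\<phi> P j a > 0"
      using \<pi> j less.prems(2) by (force simp: random_assignments_def PiE_iff)
    \<comment> \<open>Contrapositive of \<open>ge\<close>.\<close>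
    moreover have "pref_rank A (P i) a < pref_rank A (P j) a"
      using ge[of j] j by force
    \<comment> \<open>Condition (ii) with the roles swapped: \<open>j\<close> holds a share of
      \<open>a\<close>, and \<open>i\<close> ranks \<open>a\<close> higher than \<open>j\<close>
      does.\<close>
    ultimately have "(\<Sum>b\<in>?U. \<phi> P i b) = 1"
      using fair P less.prems j(1) unfolding sd_rank_fair_def by blast
    with lt1 show False by simp
  qed
qed

theorem proposition1:
  fixes N :: "'i set" and A :: "'a set" and q :: "'a \<Rightarrow> nat"
    and \<phi> :: "('i \<Rightarrow> 'a rel) \<Rightarrow> 'i \<Rightarrow> 'a \<Rightarrow> real"
  assumes "finite N" and "finite A"
    and "\<And>a. a \<in> A \<Longrightarrow> q a > 0"
    and "(\<Sum>a\<in>A. q a) \<ge> card N"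
    and "\<phi> \<in> rules N A q"
    and "sd_rank_fair N A q \<phi>"
  shows "sd_efficient N A q \<phi>"
proof -
  have "\<pi> = \<phi> P"
    if P: "P \<in> profiles N A" and \<pi>: "\<pi> \<in> random_assignments N A q"
      and dom: "\<forall>i\<in>N. sd A (P i) (\<pi> i) (\<phi> P i)" for P \<pi>
  proof -
    have \<phi>: "\<phi> P \<in> random_assignments N A q"
      using assms(5) P by (auto simp: rules_def)
    then have mem: "\<pi> \<in> N \<rightarrow>\<^sub>E (A \<rightarrow>\<^sub>E {0..})" "\<phi> P \<in> N \<rightarrow>\<^sub>E (A \<rightarrow>\<^sub>E {0..})"
      using \<pi> by (auto simp: random_assignments_def)
    show ?thesis
    proof (rule PiE_ext[OF mem])
      fix i assume i: "i \<in> N"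
      show "\<pi> i = \<phi> P i"
        using PiE_mem[OF mem(1) i] PiE_mem[OF mem(2) i]
          sd_rank_fair_dominating_eq[OF assms(1,2) P \<phi> assms(6) \<pi> _ i] dom
        by (intro PiE_ext) auto
    qed
  qed
  then show ?thesis by (auto simp: sd_efficient_def)
qed

end
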